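(* Let $\Bbbk$ be a field of characteristic zero and let $(X,r)$ be a finite, non-degenerate, involutive set-theoretic solution of the Yang–Baxter equation that is distributive. Then the Yang–Baxter algebra $A(X,r)$ of $(X,r)$ is a Zhang twist of the polynomial algebra $\Bbbk[X]$ over the set $X$; that is, there exist $p\ge 1$, an $\mathbb{N}^p$-grading on the algebra $\Bbbk[X]$, and a sequence $\phi=\{\phi_s\mid s=1,\dots,p\}$ of commuting $\mathbb{N}^p$-graded algebra automorphisms of $\Bbbk[X]$ such that $A(X,r)$ is isomorphic to the Zhang twist $\Bbbk[X]^\phi$.
   Context: A set-theoretic solution of the Yang–Baxter equation is a pair $(X,r)$ with $X$ a nonempty set and $r:X\times X\to X\times X$ a bijection such that $(\mathrm{id}\times r)(r\times\mathrm{id})(\mathrm{id}\times r)=(r\times\mathrm{id})(\mathrm{id}\times r)(r\times\mathrm{id})$ on $X^3$. Write $r(x,y)=(x\circ y,\,x\bullet y)$. The solution is non-degenerate if for every $x\in X$ the maps $\mathcal{L}_x: a\mapsto x\circ a$ and $\mathcal{R}_x: a\mapsto a\bullet x$ are bijections of $X$; it is involutive if $r^2=\mathrm{id}$; it is finite if $X$ is finite. The solution is distributive if for all $x,y,z\in X$: $x\circ(y\circ z)=(x\circ y)\circ(x\circ z)$ and $(y\bullet z)\bullet x=(y\bullet x)\bullet(z\bullet x)$. The Yang–Baxter algebra $A(X,r)$ is the associative unital $\Bbbk$-algebra $\Bbbk\langle X\rangle/(\mathbf{R}(r))$ generated by $X$ subject to the relations $xy=y'x'$ whenever $r(x,y)=(y',x')$,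 i.e. $xy=(x\circ y)(x\bullet y)$ for all $x,y\in X$. The polynomial algebra $\Bbbk[X]$ is the commutative polynomial algebra with the elements of $X$ as variables. For an $\mathbb{N}^p$-graded algebra $B$ and a sequence $\phi=\{\phi_s\mid s=1,\dots,p\}$ of commuting $\mathbb{N}^p$-graded algebra automorphisms of $B$, the Zhang twist $B^\phi$ is $B$ as an $\mathbb{N}^p$-graded vector space, with new multiplication determined by $a\star b=a\,\phi^{|a|}(b)$ for $a$ homogeneous of degree $|a|=(a_1,\dots,a_p)$, where $\phi^{|a|}=\phi_1^{a_1}\cdots\phi_p^{a_p}$. *)

theory Defs
  imports "HOL-Algebra.QuotRing" "HOL-Algebra.Module" "HOL-Library.Poly_Mapping"
begin

section \<open>Set-theoretic solutions of the Yang--Baxter equation\<close>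

text \<open>The underlying set of a solution is a whole type, which is automatically nonempty.\<close>

definition r12 :: "('x \<times> 'x \<Rightarrow> 'x \<times> 'x) \<Rightarrow> 'x \<times> 'x \<times> 'x \<Rightarrow> 'x \<times> 'x \<times> 'x"
  where "r12 r = (\<lambda>(x, y, z). (fst (r (x, y)), snd (r (x, y)), z))"

definition r23 :: "('x \<times> 'x \<Rightarrow> 'x \<times> 'x) \<Rightarrow> 'x \<times> 'x \<times> 'x \<Rightarrow> 'x \<times> 'x \<times> 'x"
  where "r23 r = (\<lambda>(x, y, z). (x, r (y, z)))"

definition set_theoretic_solution :: "('x \<times> 'x \<Rightarrow> 'x \<times> 'x) \<Rightarrow> bool"
  where "set_theoretic_solution r \<longleftrightarrow>
    bij r \<and> r23 r \<circ> r12 r \<circ> r23 r = r12 r \<circ> r23 r \<circ> r12 r"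

text \<open>The two components of \<open>r (x, y) = (x \<circ> y, x \<bullet> y)\<close>.\<close>

definition circ_op :: "('x \<times> 'x \<Rightarrow> 'x \<times> 'x) \<Rightarrow> 'x \<Rightarrow> 'x \<Rightarrow> 'x"
  where "circ_op r x y = fst (r (x, y))"

definition bullet_op :: "('x \<times> 'x \<Rightarrow> 'x \<times> 'x) \<Rightarrow> 'x \<Rightarrow> 'x \<Rightarrow> 'x"
  where "bullet_op r x y = snd (r (x, y))"

definition nondegenerate :: "('x \<times> 'x \<Rightarrow> 'x \<times> 'x) \<Rightarrow> bool"
  where "nondegenerate r \<longleftrightarrow>
    (\<forall>x. bij (\<lambda>a. circ_op r x a) \<and> bij (\<lambda>a. bullet_op r a x))"

definition involutive :: "('x \<times> 'x \<Rightarrow> 'x \<times> 'x) \<Rightarrow> bool"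
  where "involutive r \<longleftrightarrow> r \<circ> r = id"

definition distributive :: "('x \<times> 'x \<Rightarrow> 'x \<times> 'x) \<Rightarrow> bool"
  where "distributive r \<longleftrightarrow> (\<forall>x y z.
    circ_op r x (circ_op r y z) = circ_op r (circ_op r x y) (circ_op r x z) \<and>
    bullet_op r (bullet_op r y z) x = bullet_op r (bullet_op r y x) (bullet_op r z x))"

section \<open>Algebras over a field\<close>

text \<open>
  The scalars form a type \<open>'k\<close> of class \<open>field\<close>. An associative unital \<open>'k\<close>-algebra, not
  necessarily commutative, is carried by the record type \<open>('k, 'a) module\<close>, which is a ring
  record together with a scalar multiplication.
\<close>

definition algebra_iso ::
  "('k, 'a) module \<Rightarrow> ('k, 'b) module \<Rightarrow> ('a \<Rightarrow> 'b) set"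
  where "algebra_iso A B = {h \<in> ring_iso A B.
    \<forall>c. \<forall>a \<in> carrier A. h (c \<odot>\<^bsub>A\<^esub> a) = c \<odot>\<^bsub>B\<^esub> h a}"

definition algebra_isomorphic ::
  "('k, 'a) module \<Rightarrow> ('k, 'b) module \<Rightarrow> bool"
  where "algebra_isomorphic A B \<longleftrightarrow> algebra_iso A B \<noteq> {}"

text \<open>The quotient by a two-sided ideal; \<open>c \<odot> (I + a) = I + c \<odot> a\<close>.\<close>

definition quotient_algebra ::
  "('k, 'a) module \<Rightarrow> 'a set \<Rightarrow> ('k, 'a set) module"
  where "quotient_algebra A I =
    \<lparr>carrier = carrier (A Quot I), monoid.mult = monoid.mult (A Quot I), one = one (A Quot I),
     ring.zero = ring.zero (A Quot I), add = add (A Quot I),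
     smult = (\<lambda>c C. I <+>\<^bsub>A\<^esub> ((\<lambda>a. c \<odot>\<^bsub>A\<^esub> a) ` C))\<rparr>"

text \<open>
  The algebra of an additively written monoid \<open>'m\<close>: finitely supported functions with
  convolution, scalars embedded via the neutral element of \<open>'m\<close>.
\<close>

definition monoid_algebra :: "('k::field, 'm::monoid_add \<Rightarrow>\<^sub>0 'k) module"
  where "monoid_algebra =
    \<lparr>carrier = UNIV, monoid.mult = (*), one = 1, ring.zero = 0, add = (+),
     smult = (\<lambda>c f. Poly_Mapping.single 0 c * f)\<rparr>"

lemma ring_monoid_algebra:
  "ring (monoid_algebra :: ('k::field, 'm::monoid_add \<Rightarrow>\<^sub>0 'k) module)"
proof (intro ringI abelian_groupI monoidI)
  fix x :: "'m \<Rightarrow>\<^sub>0 'k"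
  show "\<exists>y\<in>carrier monoid_algebra. y \<oplus>\<^bsub>monoid_algebra\<^esub> x = \<zero>\<^bsub>monoid_algebra\<^esub>"
    by (intro bexI[of _ "- x"]) (simp_all add: monoid_algebra_def)
qed (simp_all add: monoid_algebra_def algebra_simps)

text \<open>Monomials in commuting variables are exponent vectors.\<close>

type_synonym ('x, 'k) poly_algebra = "('x \<Rightarrow>\<^sub>0 nat) \<Rightarrow>\<^sub>0 'k"

abbreviation polynomial_algebra :: "('k::field, ('x, 'k) poly_algebra) module"
  where "polynomial_algebra \<equiv> monoid_algebra"

text \<open>The free monoid of words, written additively so that convolution applies.\<close>

datatype 'x free_monoid = Word (letters: "'x list")

instantiation free_monoid :: (type) monoid_add
begin

definition zero_free_monoid :: "'a free_monoid"
  where "0 = Word []"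

definition plus_free_monoid :: "'a free_monoid \<Rightarrow> 'a free_monoid \<Rightarrow> 'a free_monoid"
  where "u + v = Word (letters u @ letters v)"

instance
  by standard (simp_all add: zero_free_monoid_def plus_free_monoid_def)

end

type_synonym ('x, 'k) free_alg = "'x free_monoid \<Rightarrow>\<^sub>0 'k"

abbreviation free_algebra :: "('k::field, ('x, 'k) free_alg) module"
  where "free_algebra \<equiv> monoid_algebra"

definition free_gen :: "'x \<Rightarrow> ('x, 'k::field) free_alg"
  where "free_gen x = Poly_Mapping.single (Word [x]) 1"

section \<open>The Yang--Baxter algebra\<close>

definition yang_baxter_relators :: "('x \<times> 'x \<Rightarrow> 'x \<times> 'x) \<Rightarrow> ('x, 'k::field) free_alg set"
  where "yang_baxter_relators r =
    {free_gen x * free_gen y - free_gen (circ_op r x y) * free_gen (bullet_op r x y) | x y. True}"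

definition yang_baxter_algebra ::
  "('x \<times> 'x \<Rightarrow> 'x \<times> 'x) \<Rightarrow> ('k::field, ('x, 'k) free_alg set) module"
  where "yang_baxter_algebra r =
    quotient_algebra free_algebra (Idl\<^bsub>free_algebra\<^esub> (yang_baxter_relators r))"

section \<open>Gradings and Zhang twists\<close>

text \<open>\<open>\<nat>\<^sup>p\<close>, as functions vanishing outside \<open>{1..p}\<close>.\<close>

definition multidegrees :: "nat \<Rightarrow> (nat \<Rightarrow> nat) set"
  where "multidegrees p = {d. \<forall>s. s \<notin> {1..p} \<longrightarrow> d s = 0}"

definition is_decomposition ::
  "nat \<Rightarrow> ('k, 'b) module \<Rightarrow> ((nat \<Rightarrow> nat) \<Rightarrow> 'b set) \<Rightarrow> 'b \<Rightarrow> ((nat \<Rightarrow> nat) \<Rightarrow> 'b) \<Rightarrow> bool"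
  where "is_decomposition p B G a c \<longleftrightarrow>
    (\<forall>d \<in> multidegrees p. c d \<in> G d) \<and>
    (\<forall>d. d \<notin> multidegrees p \<longrightarrow> c d = \<zero>\<^bsub>B\<^esub>) \<and>
    finite {d. c d \<noteq> \<zero>\<^bsub>B\<^esub>} \<and>
    a = (\<Oplus>\<^bsub>B\<^esub>d\<in>{d. c d \<noteq> \<zero>\<^bsub>B\<^esub>}. c d)"

text \<open>
  \<open>G d\<close> is the homogeneous component of degree \<open>d\<close>, a linear subspace; the values of \<open>G\<close>
  outside \<open>multidegrees p\<close> are irrelevant.
\<close>

definition is_grading ::
  "nat \<Rightarrow> ('k, 'b) module \<Rightarrow> ((nat \<Rightarrow> nat) \<Rightarrow> 'b set) \<Rightarrow> bool"
  where "is_grading p B G \<longleftrightarrow>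
    (\<forall>d \<in> multidegrees p. additive_subgroup (G d) B \<and> (\<forall>c. \<forall>a \<in> G d. c \<odot>\<^bsub>B\<^esub> a \<in> G d)) \<and>
    (\<forall>a \<in> carrier B. \<exists>!c. is_decomposition p B G a c) \<and>
    \<one>\<^bsub>B\<^esub> \<in> G (\<lambda>_. 0) \<and>
    (\<forall>d \<in> multidegrees p. \<forall>e \<in> multidegrees p. \<forall>a \<in> G d. \<forall>b \<in> G e.
      a \<otimes>\<^bsub>B\<^esub> b \<in> G (\<lambda>s. d s + e s))"

definition homogeneous_part ::
  "nat \<Rightarrow> ('k, 'b) module \<Rightarrow> ((nat \<Rightarrow> nat) \<Rightarrow> 'b set) \<Rightarrow> 'b \<Rightarrow> (nat \<Rightarrow> nat) \<Rightarrow> 'b"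
  where "homogeneous_part p B G a = (THE c. is_decomposition p B G a c)"

definition commuting_graded_automorphisms ::
  "nat \<Rightarrow> ('k, 'b) module \<Rightarrow> ((nat \<Rightarrow> nat) \<Rightarrow> 'b set) \<Rightarrow> (nat \<Rightarrow> 'b \<Rightarrow> 'b) \<Rightarrow> bool"
  where "commuting_graded_automorphisms p B G \<phi> \<longleftrightarrow>
    (\<forall>s \<in> {1..p}. \<phi> s \<in> algebra_iso B B \<and> (\<forall>d \<in> multidegrees p. \<phi> s ` G d = G d)) \<and>
    (\<forall>s \<in> {1..p}. \<forall>t \<in> {1..p}. \<forall>b \<in> carrier B. \<phi> s (\<phi> t b) = \<phi> t (\<phi> s b))"

text \<open>\<open>\<phi> 1 ^^ d 1 \<circ> \<dots> \<circ> \<phi> p ^^ d p\<close>\<close>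

definition multipower :: "nat \<Rightarrow> (nat \<Rightarrow> 'b \<Rightarrow> 'b) \<Rightarrow> (nat \<Rightarrow> nat) \<Rightarrow> 'b \<Rightarrow> 'b"
  where "multipower p \<phi> d = foldr (\<lambda>s g. (\<phi> s ^^ d s) \<circ> g) [1..<Suc p] id"

text \<open>
  The product \<open>a \<star> b = a \<phi>\<^bsup>|a|\<^esup>(b)\<close> for homogeneous \<open>a\<close>, extended additively in \<open>a\<close>.
\<close>

definition twisted_mult ::
  "nat \<Rightarrow> ('k, 'b) module \<Rightarrow> ((nat \<Rightarrow> nat) \<Rightarrow> 'b set) \<Rightarrow> (nat \<Rightarrow> 'b \<Rightarrow> 'b) \<Rightarrow> 'b \<Rightarrow> 'b \<Rightarrow> 'b"
  where "twisted_mult p B G \<phi> a b =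
    (\<Oplus>\<^bsub>B\<^esub>d\<in>{d. homogeneous_part p B G a d \<noteq> \<zero>\<^bsub>B\<^esub>}.
      homogeneous_part p B G a d \<otimes>\<^bsub>B\<^esub> multipower p \<phi> d b)"

definition zhang_twist ::
  "nat \<Rightarrow> ('k, 'b) module \<Rightarrow> ((nat \<Rightarrow> nat) \<Rightarrow> 'b set) \<Rightarrow> (nat \<Rightarrow> 'b \<Rightarrow> 'b) \<Rightarrow> ('k, 'b) module"
  where "zhang_twist p B G \<phi> = B\<lparr>monoid.mult := twisted_mult p B G \<phi>\<rparr>"

end

theory Submission
  imports Defs
begin

text \<open>
  Distributivity forces \<open>r (x, y) = (L\<^sub>x y, L\<^sub>y\<inverse> x)\<close> with commuting permutations \<open>L\<^sub>x\<close> such that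
  \<open>L\<close> is constant on the orbits of the group they generate. Give the variable \<open>x\<close> the degree
  \<open>e\<^sub>s\<close>, where \<open>s\<close> numbers the value \<open>L\<^sub>x\<close>, and let \<open>\<phi>\<^sub>s\<close> permute the variables by that value.
  The twisted product \<open>x \<star> y = x \<cdot> L\<^sub>x y\<close> is then invariant under \<open>r\<close>, so words map to monomials by
  \<open>\<pi> (x w) = x \<cdot> L\<^sub>x (\<pi> w)\<close>. This map is onto, and two words with the same image are connected by
  the defining relations, since every variable of \<open>\<pi> w\<close> can be moved to the front of \<open>w\<close>.
  Hence the kernel of the linearised map is the ideal of relations.
\<close>

section \<open>Pushing finitely supported functions forward\<close>

text \<open>Setting a coefficient at a key outside the support amounts to adding a singleton, so
  induction over updates becomes an additive principle.\<close>

lemma poly_mapping_induct_add [case_names single add]: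
  assumes "\<And>u c. P (Poly_Mapping.single u c)" and "\<And>f g. P f \<Longrightarrow> P g \<Longrightarrow> P (f + g)"
  shows "P f"
proof (induction f rule: update_induct)
  case const
  \<comment> \<open>The zero function counts as a singleton with coefficient 0 at an arbitrary
    key.\<close>
  show ?case using assms(1)[of undefined 0] by simp
next
  case (update f a b)
  have "Poly_Mapping.update a b f = f + Poly_Mapping.single a b"
    using update.hyps
    by (intro poly_mapping_eqI)
      (auto simp: lookup_update lookup_add lookup_single when_def in_keys_iff)
  then show ?case using assms update by simp
qed

lemma multiset_poly_mapping_induct [case_names zero add]:
  fixes m :: "'x \<Rightarrow>\<^sub>0 nat"
  assumes "P 0" and step: "\<And>x m. P m \<Longrightarrow> P (Poly_Mapping.single x 1 + m)"
  shows "P m"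
proof -
  \<comment> \<open>Strengthened by an arbitrary summand \<open>n\<close>: the additive induction
    splits \<open>m\<close> into pieces, while \<open>P\<close> is only known to survive the
    addition of one variable at a time.\<close>
  have "\<forall>n. P n \<longrightarrow> P (m + n)"
  proof (induction m rule: poly_mapping_induct_add)
    case (single u c)
    show ?case
    proof (induction c)
      case (Suc c)
      have "Poly_Mapping.single u (Suc c) = Poly_Mapping.single u 1 + Poly_Mapping.single u c"
        by (simp flip: single_add)
      then show ?case using Suc step by (simp add: add.assoc)
    qed simp
  qed (simp add: add.assoc)
  from this[rule_format, OF \<open>P 0\<close>] show ?thesis by simp
qed

text \<open>The linear extension of a map between bases, used on two levels: on exponent vectors it
  renames variables, on elements of a monoid algebra it renames monomials. Thus
  \<open>push_forward (push_forward T)\<close> substitutes \<open>T x\<close> for each variable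
  \<open>x\<close>.\<close>

definition push_forward :: "('a \<Rightarrow> 'b) \<Rightarrow> ('a \<Rightarrow>\<^sub>0 'k::comm_monoid_add) \<Rightarrow> ('b \<Rightarrow>\<^sub>0 'k)"
  where "push_forward f p =
    (\<Sum>u\<in>Poly_Mapping.keys p. Poly_Mapping.single (f u) (Poly_Mapping.lookup p u))"

lemma push_forward_single [simp]:
  "push_forward f (Poly_Mapping.single u c) = Poly_Mapping.single (f u) c"
  by (simp add: push_forward_def)

lemma push_forward_zero [simp]: "push_forward f 0 = 0"
  by (simp add: push_forward_def)

lemma push_forward_add [simp]: "push_forward f (p + q) = push_forward f p + push_forward f q"
  unfolding push_forward_def by (rule setsum_keys_plus_distrib) (simp_all add: single_add)

lemma push_forward_diff [simp]:
  fixes p q :: "'a \<Rightarrow>\<^sub>0 'k::ab_group_add"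
  shows "push_forward f (p - q) = push_forward f p - push_forward f q"
  using push_forward_add[of f "p - q" q] by (simp add: algebra_simps)

lemma push_forward_comp: "push_forward f (push_forward g p) = push_forward (f \<circ> g) p"
  by (induction p rule: poly_mapping_induct_add) simp_all

lemma push_forward_id [simp]: "push_forward id = id"
proof
  show "push_forward id p = id p" for p :: "'a \<Rightarrow>\<^sub>0 'k::comm_monoid_add"
    by (induction p rule: poly_mapping_induct_add) simp_all
qed

lemma push_forward_comp_fun: "push_forward (f \<circ> g) = push_forward f \<circ> push_forward g"
  by (simp add: fun_eq_iff push_forward_comp)

lemma push_forward_inverse:
  assumes "f \<circ> g = id"
  shows "push_forward f (push_forward g p) = p"
  by (simp add: push_forward_comp assms)

lemma bij_push_forward:
  assumes "bij f"
  shows "bij (push_forward f)"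
proof (rule o_bij)
  show "push_forward (inv_into UNIV f) \<circ> push_forward f = id"
    using assms by (simp add: bij_is_inj flip: push_forward_comp_fun)
  show "push_forward f \<circ> push_forward (inv_into UNIV f) = id"
    using assms[THEN bij_is_surj, unfolded surj_iff] by (simp flip: push_forward_comp_fun)
qed

lemma lookup_push_forward:
  assumes "bij f"
  shows "Poly_Mapping.lookup (push_forward f p) (f x) = Poly_Mapping.lookup p x"
  using assms
  by (induction p rule: poly_mapping_induct_add)
    (simp_all add: lookup_add lookup_single bij_is_inj inj_eq)

text \<open>Both sides are additive in \<open>p\<close> and in \<open>q\<close>, so singletons
  suffice, where the claim is the hypothesis on exponents.\<close>

lemma push_forward_mult:
  fixes p q :: "'a::monoid_add \<Rightarrow>\<^sub>0 'k::semiring_0"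
  assumes "\<And>u v. f (u + v) = f u + f v"
  shows "push_forward f (p * q) = push_forward f p * push_forward f q"
proof (induction p rule: poly_mapping_induct_add)
  case (single u c)
  show ?case
    by (induction q rule: poly_mapping_induct_add)
      (simp_all add: mult_single assms distrib_left)
qed (simp add: distrib_right)

section \<open>Iterated automorphisms\<close>

lemma funpow_commute:
  assumes "f \<circ> h = h \<circ> f"
  shows "(f ^^ n) \<circ> h = h \<circ> (f ^^ n)"
proof (induction n)
  case (Suc n)
  have "(f ^^ Suc n) \<circ> h = f \<circ> (f ^^ n \<circ> h)" by (simp add: comp_assoc)
  also have "\<dots> = h \<circ> (f ^^ Suc n)"
    using Suc assms by (metis comp_assoc funpow.simps(2))
  finally show ?case .
qed simp

lemma foldr_funpow_commute:
  assumes "\<And>s. s \<in> set xs \<Longrightarrow> \<phi> s \<circ> h = h \<circ> \<phi> s"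
  shows "foldr (\<lambda>s g. (\<phi> s ^^ d s) \<circ> g) xs id \<circ> h = h \<circ> foldr (\<lambda>s g. (\<phi> s ^^ d s) \<circ> g) xs id"
  using assms
proof (induction xs)
  case (Cons t xs)
  let ?F = "foldr (\<lambda>s g. (\<phi> s ^^ d s) \<circ> g) xs id"
  have F: "?F \<circ> h = h \<circ> ?F" by (rule Cons.IH, rule Cons.prems) simp
  have A: "(\<phi> t ^^ d t) \<circ> h = h \<circ> (\<phi> t ^^ d t)"
    by (rule funpow_commute[OF Cons.prems]) simp
  have step: "foldr (\<lambda>s g. (\<phi> s ^^ d s) \<circ> g) (t # xs) id = (\<phi> t ^^ d t) \<circ> ?F"
    by simp
  have "(\<phi> t ^^ d t) \<circ> ?F \<circ> h = (\<phi> t ^^ d t) \<circ> h \<circ> ?F"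
    unfolding comp_assoc F ..
  also have "\<dots> = h \<circ> ((\<phi> t ^^ d t) \<circ> ?F)"
    unfolding A comp_assoc ..
  finally show ?case unfolding step .
qed simp

text \<open>Commutation lets the factor \<open>\<phi> t ^^ e t\<close> pass across the powers with
  exponents \<open>d\<close> that belong to later indices.\<close>

lemma multipower_add:
  assumes "\<And>s t. s \<in> {1..p} \<Longrightarrow> t \<in> {1..p} \<Longrightarrow> \<phi> s \<circ> \<phi> t = \<phi> t \<circ> \<phi> s"
  shows "multipower p \<phi> (\<lambda>s. d s + e s) = multipower p \<phi> d \<circ> multipower p \<phi> e"
proof -
  have foldr_add: "foldr (\<lambda>s g. (\<phi> s ^^ (d s + e s)) \<circ> g) xs id =
      foldr (\<lambda>s g. (\<phi> s ^^ d s) \<circ> g) xs id \<circ> foldr (\<lambda>s g. (\<phi> s ^^ e s) \<circ> g) xs id"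
    if "set xs \<subseteq> {1..p}" for xs
    using that
  proof (induction xs)
    case (Cons t xs)
    let ?D = "foldr (\<lambda>s g. (\<phi> s ^^ d s) \<circ> g) xs id"
    let ?E = "foldr (\<lambda>s g. (\<phi> s ^^ e s) \<circ> g) xs id"
    have DE: "?D \<circ> (\<phi> t ^^ e t) = (\<phi> t ^^ e t) \<circ> ?D"
    proof (rule foldr_funpow_commute)
      fix s assume "s \<in> set xs"
      then have "\<phi> t \<circ> \<phi> s = \<phi> s \<circ> \<phi> t" using assms Cons.prems by auto
      then show "\<phi> s \<circ> (\<phi> t ^^ e t) = (\<phi> t ^^ e t) \<circ> \<phi> s" by (metis funpow_commute)
    qed
    have IH: "foldr (\<lambda>s g. (\<phi> s ^^ (d s + e s)) \<circ> g) xs id = ?D \<circ> ?E"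
      using Cons.prems by (intro Cons.IH) simp
    have "foldr (\<lambda>s g. (\<phi> s ^^ (d s + e s)) \<circ> g) (t # xs) id =
        (\<phi> t ^^ (d t + e t)) \<circ> foldr (\<lambda>s g. (\<phi> s ^^ (d s + e s)) \<circ> g) xs id"
      by simp
    also have "\<dots> = (\<phi> t ^^ d t) \<circ> (\<phi> t ^^ e t) \<circ> (?D \<circ> ?E)"
      by (rule arg_cong2[where f = "(\<circ>)", OF funpow_add IH])
    also have "\<dots> = (\<phi> t ^^ d t) \<circ> ((\<phi> t ^^ e t) \<circ> ?D) \<circ> ?E"
      by (simp only: comp_assoc)
    also have "\<dots> = (\<phi> t ^^ d t) \<circ> (?D \<circ> (\<phi> t ^^ e t)) \<circ> ?E"
      by (rule arg_cong[where f = "\<lambda>h. (\<phi> t ^^ d t) \<circ> h \<circ> ?E", OF DE[symmetric]])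
    also have "\<dots> = foldr (\<lambda>s g. (\<phi> s ^^ d s) \<circ> g) (t # xs) id \<circ>
        foldr (\<lambda>s g. (\<phi> s ^^ e s) \<circ> g) (t # xs) id"
      by (simp add: fun_eq_iff)
    finally show ?case .
  qed simp
  show ?thesis unfolding multipower_def by (rule foldr_add) auto
qed

lemma multipower_unit:
  assumes "t \<in> {1..p}"
  shows "multipower p \<phi> (\<lambda>s. if s = t then 1 else 0) = \<phi> t"
proof -
  have "foldr (\<lambda>s g. (\<phi> s ^^ (if s = t then 1 else 0)) \<circ> g) xs id =
      (if t \<in> set xs then \<phi> t else id)" if "distinct xs" for xs
    using that by (induction xs) auto
  from this[of "[1..<Suc p]"] show ?thesis using assms by (simp add: multipower_def del: upt_Suc)
qed

lemma multipower_zero: "multipower p \<phi> (\<lambda>_. 0) = id"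
proof -
  have "foldr (\<lambda>s g. (\<phi> s ^^ 0) \<circ> g) xs id = id" for xs by (induction xs) simp_all
  then show ?thesis by (simp add: multipower_def del: upt_Suc)
qed

text \<open>Respecting identity and composition, \<open>F\<close> respects powers and products. It
  will carry permutations of the variables to the automorphisms they induce on polynomials.\<close>

lemma multipower_functor:
  assumes "F id = id" and "\<And>f g. F (f \<circ> g) = F f \<circ> F g"
  shows "multipower p (\<lambda>s. F (\<phi> s)) d = F (multipower p \<phi> d)"
proof -
  have pow: "F f ^^ n = F (f ^^ n)" for f n
    by (induction n) (simp_all only: funpow.simps assms)
  have "foldr (\<lambda>s g. (F (\<phi> s) ^^ d s) \<circ> g) xs id = F (foldr (\<lambda>s g. (\<phi> s ^^ d s) \<circ> g) xs id)" for xs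
  proof (induction xs)
    case Nil
    show ?case by (metis foldr.simps(1) id_apply assms(1))
  next
    case (Cons t xs)
    have "foldr (\<lambda>s g. (F (\<phi> s) ^^ d s) \<circ> g) (t # xs) id =
        (F (\<phi> t) ^^ d t) \<circ> foldr (\<lambda>s g. (F (\<phi> s) ^^ d s) \<circ> g) xs id"
      by simp
    also have "\<dots> = F (\<phi> t ^^ d t) \<circ> F (foldr (\<lambda>s g. (\<phi> s ^^ d s) \<circ> g) xs id)"
      by (rule arg_cong2[where f = "(\<circ>)", OF pow Cons])
    also have "\<dots> = F ((\<phi> t ^^ d t) \<circ> foldr (\<lambda>s g. (\<phi> s ^^ d s) \<circ> g) xs id)"
      by (rule assms(2)[symmetric])
    also have "\<dots> = F (foldr (\<lambda>s g. (\<phi> s ^^ d s) \<circ> g) (t # xs) id)"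
      by (rule arg_cong[where f = F]) simp
    finally show ?case .
  qed
  then show ?thesis by (simp only: multipower_def)
qed

section \<open>Monoid algebras graded by a degree function\<close>

lemma monoid_algebra_simps:
  "carrier monoid_algebra = UNIV" "\<one>\<^bsub>monoid_algebra\<^esub> = 1" "\<zero>\<^bsub>monoid_algebra\<^esub> = 0"
  "f \<otimes>\<^bsub>monoid_algebra\<^esub> g = f * g" "f \<oplus>\<^bsub>monoid_algebra\<^esub> g = f + g"
  "c \<odot>\<^bsub>monoid_algebra\<^esub> f = Poly_Mapping.single 0 c * f"
  by (simp_all add: monoid_algebra_def)

lemma finsum_monoid_algebra:
  assumes "finite S"
  shows "(\<Oplus>\<^bsub>monoid_algebra\<^esub>d\<in>S. c d) = (\<Sum>d\<in>S. c d)"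
proof -
  interpret ring "monoid_algebra :: ('k::field, 'm::monoid_add \<Rightarrow>\<^sub>0 'k) module"
    by (rule ring_monoid_algebra)
  show ?thesis
    using assms
  proof (induction S)
    case empty
    show ?case by (simp add: finsum_empty) (simp add: monoid_algebra_def)
  next
    case (insert d S)
    have "c \<in> S \<rightarrow> carrier monoid_algebra" "c d \<in> carrier monoid_algebra"
      by (simp_all add: monoid_algebra_def)
    then show ?case using insert by (simp add: finsum_insert) (simp add: monoid_algebra_def)
  qed
qed

definition degree_component :: "('m \<Rightarrow> nat \<Rightarrow> nat) \<Rightarrow> (nat \<Rightarrow> nat) \<Rightarrow> ('m \<Rightarrow>\<^sub>0 'k::zero) set"
  where "degree_component deg d = {f. \<forall>u \<in> Poly_Mapping.keys f. deg u = d}"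

text \<open>Written as a sum of terms rather than as a restriction of \<open>f\<close>, so that
  products with a homogeneous part expand monomial by monomial.\<close>

definition degree_part ::
  "('m \<Rightarrow> nat \<Rightarrow> nat) \<Rightarrow> ('m \<Rightarrow>\<^sub>0 'k::comm_monoid_add) \<Rightarrow> (nat \<Rightarrow> nat) \<Rightarrow> ('m \<Rightarrow>\<^sub>0 'k)"
  where "degree_part deg f d =
    (\<Sum>u\<in>{u \<in> Poly_Mapping.keys f. deg u = d}. Poly_Mapping.single u (Poly_Mapping.lookup f u))"

lemma lookup_degree_part:
  "Poly_Mapping.lookup (degree_part deg f d) u = (if deg u = d then Poly_Mapping.lookup f u else 0)"
proof -
  have "Poly_Mapping.lookup (degree_part deg f d) u =
      (\<Sum>v\<in>{v \<in> Poly_Mapping.keys f. deg v = d}. if v = u then Poly_Mapping.lookup f u else 0)"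
    unfolding degree_part_def lookup_sum by (rule sum.cong) (auto simp: lookup_single when_def)
  then show ?thesis by (simp add: in_keys_iff)
qed

lemma support_degree_part: "{d. degree_part deg f d \<noteq> 0} \<subseteq> deg ` Poly_Mapping.keys f"
proof
  fix d assume "d \<in> {d. degree_part deg f d \<noteq> 0}"
  then obtain u where "Poly_Mapping.lookup (degree_part deg f d) u \<noteq> 0"
    by (auto simp: poly_mapping_eq_iff fun_eq_iff)
  then show "d \<in> deg ` Poly_Mapping.keys f"
    by (auto simp: lookup_degree_part in_keys_iff split: if_splits)
qed

lemma finite_support_degree_part: "finite {d. degree_part deg f d \<noteq> 0}"
  by (rule finite_subset[OF support_degree_part]) simp

locale degree_function =
  fixes p :: nat and deg :: "'m::monoid_add \<Rightarrow> nat \<Rightarrow> nat"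
  assumes deg_mem: "deg u \<in> multidegrees p"
    and deg_zero: "deg 0 = (\<lambda>_. 0)"
    and deg_add: "deg (u + v) = (\<lambda>s. deg u s + deg v s)"
begin

text \<open>A monomial \<open>u\<close> can occur only in the component of degree
  \<open>deg u\<close>, so any decomposition is read off from the coefficients of \<open>f\<close>.
  The equivalence contains existence and uniqueness at once.\<close>

lemma is_decomposition_iff:
  fixes f :: "'m \<Rightarrow>\<^sub>0 'k::field"
  shows "is_decomposition p monoid_algebra (degree_component deg) f c \<longleftrightarrow> c = degree_part deg f"
proof
  assume "is_decomposition p monoid_algebra (degree_component deg) f c"
  then have comp: "\<And>d. d \<in> multidegrees p \<Longrightarrow> c d \<in> degree_component deg d"
    and out: "\<And>d. d \<notin> multidegrees p \<Longrightarrow> c d = 0"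
    and fin: "finite {d. c d \<noteq> 0}" and f: "f = (\<Sum>d\<in>{d. c d \<noteq> 0}. c d)"
    by (simp_all add: is_decomposition_def finsum_monoid_algebra)
      (simp_all add: monoid_algebra_def finsum_monoid_algebra[unfolded monoid_algebra_def])
  have zero: "Poly_Mapping.lookup (c d) u = 0" if "deg u \<noteq> d" for d u
    using comp[of d] out[of d] that
    by (cases "d \<in> multidegrees p") (auto simp: degree_component_def in_keys_iff)
  have "Poly_Mapping.lookup f u = Poly_Mapping.lookup (c (deg u)) u" for u
  proof -
    have "Poly_Mapping.lookup f u = (\<Sum>d\<in>{d. c d \<noteq> 0}. Poly_Mapping.lookup (c d) u)"
      by (subst f) (simp add: lookup_sum)
    also have "\<dots> = (\<Sum>d\<in>{d. c d \<noteq> 0}. if d = deg u then Poly_Mapping.lookup (c (deg u)) u else 0)"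
      by (rule sum.cong) (auto simp: zero)
    also have "\<dots> = Poly_Mapping.lookup (c (deg u)) u"
      using fin by simp
    finally show ?thesis .
  qed
  then show "c = degree_part deg f"
    by (intro ext poly_mapping_eqI) (auto simp: lookup_degree_part zero)
next
  assume c: "c = degree_part deg f"
  have "f = (\<Sum>d\<in>{d. degree_part deg f d \<noteq> 0}. degree_part deg f d)"
  proof (rule poly_mapping_eqI)
    fix u
    have "(\<Sum>d\<in>{d. degree_part deg f d \<noteq> 0}. Poly_Mapping.lookup (degree_part deg f d) u) =
        (\<Sum>d\<in>{d. degree_part deg f d \<noteq> 0}. if d = deg u then Poly_Mapping.lookup f u else 0)"
      by (rule sum.cong) (auto simp: lookup_degree_part)
    also have "\<dots> = Poly_Mapping.lookup f u"
    \<comment> \<open>If the coefficient is nonzero, \<open>deg u\<close> is among the summation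
      indices; otherwise every summand is 0.\<close>
    proof (cases "Poly_Mapping.lookup f u = 0")
      case False
      then have "degree_part deg f (deg u) \<noteq> 0"
        by (metis lookup_degree_part lookup_zero)
      then show ?thesis by (simp add: finite_support_degree_part)
    qed (auto intro: sum.neutral)
    finally show "Poly_Mapping.lookup f u =
        Poly_Mapping.lookup (\<Sum>d\<in>{d. degree_part deg f d \<noteq> 0}. degree_part deg f d) u"
      by (simp add: lookup_sum)
  qed
  moreover have "degree_part deg f d = 0" if "d \<notin> multidegrees p" for d
    using that deg_mem by (auto intro!: poly_mapping_eqI simp: lookup_degree_part)
  moreover have "degree_part deg f d \<in> degree_component deg d" for d
    by (auto simp: degree_component_def in_keys_iff lookup_degree_part split: if_splits)
  moreover have "\<zero>\<^bsub>monoid_algebra\<^esub> = (0 :: 'm \<Rightarrow>\<^sub>0 'k)"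
    by (simp add: monoid_algebra_def)
  ultimately show "is_decomposition p monoid_algebra (degree_component deg) f c"
    by (simp add: is_decomposition_def finsum_monoid_algebra finite_support_degree_part c)
qed

lemma homogeneous_part_eq:
  "homogeneous_part p monoid_algebra (degree_component deg) f = degree_part deg f"
  by (simp add: homogeneous_part_def is_decomposition_iff)

lemma degree_component_mult:
  fixes f g :: "'m \<Rightarrow>\<^sub>0 'k::semiring_0"
  assumes "f \<in> degree_component deg d" and "g \<in> degree_component deg e"
  shows "f * g \<in> degree_component deg (\<lambda>s. d s + e s)"
  using assms keys_mult[of f g] by (fastforce simp: degree_component_def deg_add)

lemma is_grading_degree_component:
  "is_grading p (monoid_algebra :: ('k::field, 'm \<Rightarrow>\<^sub>0 'k) module) (degree_component deg)"
proof -
  let ?A = "monoid_algebra :: ('k, 'm \<Rightarrow>\<^sub>0 'k) module"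
  interpret ring ?A by (rule ring_monoid_algebra)
  have "additive_subgroup (degree_component deg d) ?A" for d
  proof (unfold additive_subgroup_def, rule group.subgroupI)
    show "group (add_monoid ?A)" by (rule a_group)
    show "degree_component deg d \<noteq> {}"
      by (auto simp: degree_component_def intro: exI[of _ 0])
    fix f :: "'m \<Rightarrow>\<^sub>0 'k" assume f: "f \<in> degree_component deg d"
    then have "- f \<in> degree_component deg d"
      by (auto simp: degree_component_def in_keys_iff)
    moreover have "\<ominus>\<^bsub>?A\<^esub> f = - f"
      by (rule minus_equality) (simp_all add: monoid_algebra_def)
    ultimately show "inv\<^bsub>add_monoid ?A\<^esub> f \<in> degree_component deg d"
      by (simp add: a_inv_def)
    fix g :: "'m \<Rightarrow>\<^sub>0 'k" assume "g \<in> degree_component deg d"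
    with f show "f \<otimes>\<^bsub>add_monoid ?A\<^esub> g \<in> degree_component deg d"
      using Poly_Mapping.keys_add[of f g] by (auto simp: degree_component_def monoid_algebra_def)
  qed (simp add: monoid_algebra_def)
  moreover have "c \<odot>\<^bsub>?A\<^esub> f \<in> degree_component deg d" if "f \<in> degree_component deg d" for c f d
  proof -
    \<comment> \<open>Scalars act as multiplication by elements of degree zero, so closure under
      them is a case of multiplicativity.\<close>
    have "Poly_Mapping.single 0 c \<in> degree_component deg (\<lambda>_. 0)"
      by (simp add: degree_component_def deg_zero)
    from degree_component_mult[OF this that] show ?thesis by (simp add: monoid_algebra_def)
  qed
  moreover have "\<one>\<^bsub>?A\<^esub> \<in> degree_component deg (\<lambda>_. 0)"
    by (simp add: degree_component_def monoid_algebra_def deg_zero)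
  moreover have "f \<otimes>\<^bsub>?A\<^esub> g \<in> degree_component deg (\<lambda>s. d s + e s)"
    if "f \<in> degree_component deg d" "g \<in> degree_component deg e" for f g d e
    using degree_component_mult[OF that] by (simp add: monoid_algebra_def)
  ultimately show ?thesis
    by (simp add: is_grading_def is_decomposition_iff)
qed

text \<open>Grouping the monomials of \<open>f\<close> by degree recovers its homogeneous parts, so
  the product expands over single monomials.\<close>

lemma twisted_mult_eq:
  fixes f g :: "'m \<Rightarrow>\<^sub>0 'k::field"
  shows "twisted_mult p monoid_algebra (degree_component deg) \<phi> f g =
    (\<Sum>u\<in>Poly_Mapping.keys f. Poly_Mapping.single u (Poly_Mapping.lookup f u) * multipower p \<phi> (deg u) g)"
proof -
  let ?t = "\<lambda>u. Poly_Mapping.single u (Poly_Mapping.lookup f u) * multipower p \<phi> (deg u) g"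
  have "twisted_mult p monoid_algebra (degree_component deg) \<phi> f g =
      (\<Sum>d\<in>{d. degree_part deg f d \<noteq> 0}. degree_part deg f d * multipower p \<phi> d g)"
    using finsum_monoid_algebra[OF finite_support_degree_part]
    by (simp add: twisted_mult_def homogeneous_part_eq) (simp add: monoid_algebra_def)
  also have "\<dots> = (\<Sum>d\<in>deg ` Poly_Mapping.keys f. degree_part deg f d * multipower p \<phi> d g)"
    by (rule sum.mono_neutral_left[OF _ support_degree_part]) auto
  also have "\<dots> = (\<Sum>d\<in>deg ` Poly_Mapping.keys f. \<Sum>u\<in>{u \<in> Poly_Mapping.keys f. deg u = d}. ?t u)"
    by (simp add: degree_part_def sum_distrib_right)
  also have "\<dots> = (\<Sum>u\<in>Poly_Mapping.keys f. ?t u)"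
    by (rule sum.image_gen[symmetric]) simp
  finally show ?thesis .
qed

end

section \<open>Quotients of monoid algebras\<close>

lemma ideal_monoid_algebra_closed:
  fixes I :: "('m::monoid_add \<Rightarrow>\<^sub>0 'k::field) set"
  assumes "ideal I monoid_algebra"
  shows "0 \<in> I" and "f \<in> I \<Longrightarrow> g \<in> I \<Longrightarrow> f + g \<in> I"
    and "f \<in> I \<Longrightarrow> g * f \<in> I" and "f \<in> I \<Longrightarrow> f * g \<in> I"
proof -
  interpret ideal I monoid_algebra by fact
  show "0 \<in> I" 
    using additive_subgroup.zero_closed[OF is_additive_subgroup] by (simp add: monoid_algebra_def)
  show "f \<in> I \<Longrightarrow> g \<in> I \<Longrightarrow> f + g \<in> I" 
    using additive_subgroup.a_closed[OF is_additive_subgroup, of f g] by (simp add: monoid_algebra_def)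
  show "f \<in> I \<Longrightarrow> g * f \<in> I" using I_l_closed[of f g] by (simp add: monoid_algebra_def)
  show "f \<in> I \<Longrightarrow> f * g \<in> I" using I_r_closed[of f g] by (simp add: monoid_algebra_def)
qed

text \<open>With a section \<open>s\<close> of \<open>\<pi>\<close>, every \<open>f\<close> is
  congruent modulo \<open>I\<close> to \<open>push_forward s (push_forward \<pi> f)\<close>, since
  each monomial is congruent to the chosen one in its fibre. On the kernel this representative is
  0.\<close>

lemma kernel_push_forward_subset:
  fixes I :: "('m::monoid_add \<Rightarrow>\<^sub>0 'k::field) set"
  assumes I: "ideal I monoid_algebra"
    and fibre: "\<And>u v. \<pi> u = \<pi> v \<Longrightarrow> Poly_Mapping.single u 1 - Poly_Mapping.single v 1 \<in> I"
    and f: "push_forward \<pi> f = 0"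
  shows "f \<in> I"
proof -
  define s where "s = inv_into UNIV \<pi>"
  have "f - push_forward s (push_forward \<pi> f) \<in> I" for f
  proof (induction f rule: poly_mapping_induct_add)
    case (single u c)
    have "\<pi> u = \<pi> (s (\<pi> u))" by (simp add: s_def f_inv_into_f)
    from ideal_monoid_algebra_closed(3)[OF I fibre[OF this], of "Poly_Mapping.single 0 c"]
    show ?case by (simp add: right_diff_distrib mult_single)
  next
    case (add f g)
    from ideal_monoid_algebra_closed(2)[OF I this] show ?case by (simp add: algebra_simps)
  qed
  from this[of f] show ?thesis by (simp add: f)
qed

text \<open>First isomorphism theorem for algebras. The library gives the ring isomorphism; what
  remains is compatibility with scalars, whose action on the quotient is defined on whole
  cosets.\<close>

lemma quotient_algebra_isomorphic:
  fixes A :: "('k::field, 'm::monoid_add \<Rightarrow>\<^sub>0 'k) module" and B :: "('k, 'b) module"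
  assumes A: "A = monoid_algebra" and hom: "ring_hom_ring A B h"
    and surj: "range h = carrier B"
    and smult: "\<And>c f. h (c \<odot>\<^bsub>A\<^esub> f) = c \<odot>\<^bsub>B\<^esub> h f"
  shows "algebra_isomorphic (quotient_algebra A (a_kernel A B h)) B"
proof -
  interpret ring_hom_ring A B h by fact
  have carr: "carrier A = UNIV" by (simp add: A monoid_algebra_def)
  define K where "K = a_kernel A B h"
  have K: "K = {f. h f = \<zero>\<^bsub>B\<^esub>}" unfolding K_def a_kernel_def' carr by simp
  have K0: "\<zero>\<^bsub>A\<^esub> \<in> K" by (simp add: K)
  define \<eta> where "\<eta> = (\<lambda>X. the_elem (h ` X))"
  have iso: "\<eta> \<in> ring_iso (A Quot K) B"
    unfolding \<eta>_def K_def using surj by (intro FactRing_iso_set) (simp add: carr)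
  have "\<eta> (c \<odot>\<^bsub>quotient_algebra A K\<^esub> X) = c \<odot>\<^bsub>B\<^esub> \<eta> X" if mem: "X \<in> carrier (A Quot K)" for c X
  proof -
    obtain a where X: "X = K +>\<^bsub>A\<^esub> a"
      using mem unfolding FactRing_def A_RCOSETS_def' by auto
    have hX: "h f = h a" if "f \<in> X" for f
      using that by (auto simp: X a_r_coset_def' K carr)
    have a: "a \<in> X" using K0 by (force simp: X a_r_coset_def' carr)
    have "h ` X = {h a}" using hX a by blast
    then have "\<eta> X = h a" by (simp add: \<eta>_def)
    \<comment> \<open>It suffices that \<open>h\<close> is constant on the scaled coset, because
      \<open>\<eta>\<close> reads off the only element of the image.\<close>
    moreover have "h ` (c \<odot>\<^bsub>quotient_algebra A K\<^esub> X) = {c \<odot>\<^bsub>B\<^esub> h a}"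
    proof -
      have *: "h (k \<oplus>\<^bsub>A\<^esub> (c \<odot>\<^bsub>A\<^esub> f)) = c \<odot>\<^bsub>B\<^esub> h a" if "k \<in> K" "f \<in> X" for k f
      proof -
        have "c \<odot>\<^bsub>B\<^esub> h a = h (c \<odot>\<^bsub>A\<^esub> f)" using hX[OF that(2)] by (simp add: smult)
        then show ?thesis using that(1) by (simp add: carr K)
      qed
      have mem_iff: "y \<in> c \<odot>\<^bsub>quotient_algebra A K\<^esub> X \<longleftrightarrow>
          (\<exists>k\<in>K. \<exists>f\<in>X. y = k \<oplus>\<^bsub>A\<^esub> (c \<odot>\<^bsub>A\<^esub> f))" for y
        by (auto simp: quotient_algebra_def set_add_def')
      show ?thesis
      proof (intro equalityI subsetI)
        fix y assume "y \<in> h ` (c \<odot>\<^bsub>quotient_algebra A K\<^esub> X)"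
        then obtain z where z: "z \<in> c \<odot>\<^bsub>quotient_algebra A K\<^esub> X" "y = h z" by (rule imageE)
        then obtain k f where "k \<in> K" "f \<in> X" "z = k \<oplus>\<^bsub>A\<^esub> (c \<odot>\<^bsub>A\<^esub> f)"
          unfolding mem_iff by blast
        then show "y \<in> {c \<odot>\<^bsub>B\<^esub> h a}" using * z(2) by blast
      next
        fix y assume "y \<in> {c \<odot>\<^bsub>B\<^esub> h a}"
        then have "y = h (\<zero>\<^bsub>A\<^esub> \<oplus>\<^bsub>A\<^esub> (c \<odot>\<^bsub>A\<^esub> a))" unfolding *[OF K0 a] by (rule singletonD)
        moreover have "\<zero>\<^bsub>A\<^esub> \<oplus>\<^bsub>A\<^esub> (c \<odot>\<^bsub>A\<^esub> a) \<in> c \<odot>\<^bsub>quotient_algebra A K\<^esub> X"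
          unfolding mem_iff using K0 a by blast
        ultimately show "y \<in> h ` (c \<odot>\<^bsub>quotient_algebra A K\<^esub> X)" by (rule image_eqI)
      qed
    qed
    ultimately show ?thesis by (simp add: \<eta>_def)
  qed
  moreover have "\<eta> \<in> ring_iso (quotient_algebra A K) B"
    using iso by (simp add: ring_iso_def ring_hom_def quotient_algebra_def)
  ultimately have "\<eta> \<in> algebra_iso (quotient_algebra A K) B"
    by (simp add: algebra_iso_def) (simp add: quotient_algebra_def)
  then show ?thesis unfolding algebra_isomorphic_def K_def by blast
qed

text \<open>A scalar acts by multiplication with a constant, and constants are fixed since
  \<open>T 0 = 0\<close>; linearity is thus part of multiplicativity.\<close>

lemma push_forward_algebra_iso:
  assumes "bij T" and "\<And>u v. T (u + v) = T u + T v" and "T 0 = 0"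
  shows "push_forward T \<in>
    algebra_iso (monoid_algebra :: ('k::field, 'm::monoid_add \<Rightarrow>\<^sub>0 'k) module) monoid_algebra"
proof -
  have one: "push_forward T (1 :: 'm \<Rightarrow>\<^sub>0 'k) = 1"
    using push_forward_single[of T 0 "1 :: 'k"] by (simp add: assms(3))
  show ?thesis
    using bij_push_forward[OF assms(1)]
    by (simp add: algebra_iso_def ring_iso_def ring_hom_def monoid_algebra_def push_forward_mult
        assms one)
qed

section \<open>Distributive solutions\<close>

locale distributive_solution =
  fixes r :: "'x \<times> 'x \<Rightarrow> 'x \<times> 'x"
  assumes solution: "set_theoretic_solution r"
    and nondeg: "nondegenerate r"
    and invol: "involutive r"
    and distr: "distributive r"
begin

section \<open>Identities for the left translations\<close>

abbreviation L :: "'x \<Rightarrow> 'x \<Rightarrow> 'x" where "L \<equiv> circ_op r"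
abbreviation R :: "'x \<Rightarrow> 'x \<Rightarrow> 'x" where "R \<equiv> bullet_op r"

lemma bij_L: "bij (L x)"
  using nondeg by (simp add: nondegenerate_def)

text \<open>This is the first component of the braid equation at \<open>(x, y, z)\<close>.\<close>

lemma braid: "L (L x y) (L (R x y) z) = L x (L y z)"
proof -
  have "(r23 r \<circ> r12 r \<circ> r23 r) (x, y, z) = (r12 r \<circ> r23 r \<circ> r12 r) (x, y, z)"
    using solution by (simp add: set_theoretic_solution_def)
  then show ?thesis
    by (simp add: r12_def r23_def circ_op_def bullet_op_def case_prod_beta)
qed

lemma involution: "L (L x y) (R x y) = x" "R (L x y) (R x y) = y"
proof -
  have "r (r (x, y)) = (x, y)"
    using invol by (simp add: involutive_def fun_eq_iff)
  then show "L (L x y) (R x y) = x" "R (L x y) (R x y) = y"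
    by (simp_all add: circ_op_def bullet_op_def)
qed

lemma left_distributive: "L x (L y z) = L (L x y) (L x z)"
  using distr by (simp add: distributive_def)

text \<open>The braid equation and left distributivity express \<open>L x (L y z)\<close> in two
  ways with the same outer map \<open>L (L x y)\<close>, which is injective.\<close>

lemma L_R: "L (R x y) = L x"
proof
  fix z
  have "L (L x y) (L (R x y) z) = L (L x y) (L x z)"
    by (simp add: braid left_distributive[of x y z])
  then show "L (R x y) z = L x z"
    using bij_L by (metis bij_is_inj injD)
qed

text \<open>By involutivity \<open>y\<close> is the right component of
  \<open>r (L x y, R x y)\<close>, so \<open>L_R\<close> applies to that pair.\<close>

lemma L_L: "L (L x y) = L y"
  by (metis L_R involution(2))

lemma L_commute: "L x (L y z) = L y (L x z)"
  using left_distributive by (simp add: L_L)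

text \<open>Hence \<open>R x y\<close> is the preimage of \<open>x\<close> under \<open>L y\<close>:
  the left translations determine the solution.\<close>

lemma L_R_cancel: "L y (R x y) = x"
  using involution(1)[of x y] by (simp add: L_L)

section \<open>Monomials and permutations of words\<close>

abbreviation permute :: "'x \<Rightarrow> ('x \<Rightarrow>\<^sub>0 nat) \<Rightarrow> ('x \<Rightarrow>\<^sub>0 nat)"
  where "permute x \<equiv> push_forward (L x)"

text \<open>The map \<open>\<pi>\<close> of the overview: the twisted product of the letters, in
  which each letter permutes everything to its right.\<close>

fun word_monomial :: "'x list \<Rightarrow> 'x \<Rightarrow>\<^sub>0 nat"
  where
    "word_monomial [] = 0"
  | "word_monomial (x # w) = Poly_Mapping.single x 1 + permute x (word_monomial w)"

definition word_action :: "'x list \<Rightarrow> 'x \<Rightarrow> 'x"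
  where "word_action w = foldr L w"

lemma word_monomial_append:
  "word_monomial (u @ v) = word_monomial u + push_forward (word_action u) (word_monomial v)"
proof (induction u)
  case Nil
  show ?case by (simp add: word_action_def flip: id_def)
next
  case (Cons x u)
  have "push_forward (word_action (x # u)) m = permute x (push_forward (word_action u) m)" for m
    by (simp add: word_action_def push_forward_comp comp_def)
  then show ?case using Cons by (simp add: add.assoc)
qed

lemma surj_word_monomial: "surj word_monomial"
proof -
  have "\<forall>T. push_forward T m \<in> range word_monomial" for m :: "'x \<Rightarrow>\<^sub>0 nat"
  proof (induction m rule: multiset_poly_mapping_induct)
    case zero
    then show ?case using rangeI[of word_monomial "[]"] by simp
  next
    case (add x m)
    show ?case
    proof
      fix T :: "'x \<Rightarrow> 'x"
      \<comment> \<open>The inverse of \<open>L (T x)\<close> is built in because the leading letter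
        \<open>T x\<close> will apply \<open>L (T x)\<close> to the rest of the word.\<close>
      obtain w where w: "push_forward (inv_into UNIV (L (T x)) \<circ> T) m = word_monomial w"
        using add by blast
      have "L (T x) \<circ> (inv_into UNIV (L (T x)) \<circ> T) = T"
        using bij_L by (simp add: fun_eq_iff bij_is_surj surj_f_inv_f)
      then have "push_forward T (Poly_Mapping.single x 1 + m) = word_monomial (T x # w)"
        by (simp add: push_forward_comp flip: w)
      then show "push_forward T (Poly_Mapping.single x 1 + m) \<in> range word_monomial"
        by (metis rangeI)
    qed
  qed
  then have "push_forward id m \<in> range word_monomial" for m :: "'x \<Rightarrow>\<^sub>0 nat" by blast
  then show ?thesis by auto
qed

section \<open>Rewriting words by the defining relations\<close>

inductive word_rewrite :: "'x list \<Rightarrow> 'x list \<Rightarrow> bool"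
  where
    refl: "word_rewrite w w"
  | trans: "word_rewrite u v \<Longrightarrow> word_rewrite v w \<Longrightarrow> word_rewrite u w"
  | Cons: "word_rewrite u v \<Longrightarrow> word_rewrite (x # u) (x # v)"
  | swap: "word_rewrite (x # y # w) (L x y # R x y # w)"

text \<open>In a swap the first two letters contribute the variables \<open>x\<close> and
  \<open>L x y\<close> on both sides, by \<open>L_L\<close> and \<open>L_R_cancel\<close>; the tail
  is acted on by the same composite because left translations commute.\<close>

lemma word_rewrite_monomial: "word_rewrite u v \<Longrightarrow> word_monomial u = word_monomial v"
proof (induction rule: word_rewrite.induct)
  case (swap x y w)
  have "L x \<circ> L y = L y \<circ> L x" by (simp add: fun_eq_iff L_commute)
  then show ?case
    by (simp add: push_forward_comp L_L L_R L_R_cancel add_ac)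
qed simp_all

text \<open>A variable \<open>y\<close> other than the first letter \<open>x\<close> comes from a
  variable \<open>z\<close> of the tail with \<open>L x z = y\<close>. Once \<open>z\<close> leads
  the tail, one swap of \<open>x\<close> and \<open>z\<close> puts \<open>y\<close> in
  front.\<close>

lemma word_rewrite_to_front:
  assumes "Poly_Mapping.lookup (word_monomial w) y \<noteq> 0"
  shows "\<exists>v. word_rewrite w (y # v)"
  using assms
proof (induction w arbitrary: y)
  case (Cons x w)
  show ?case
  proof (cases "y = x")
    case True
    then show ?thesis using refl by blast
  next
    case False
    obtain z where z: "y = L x z" using bij_L by (metis bij_pointE)
    have "Poly_Mapping.lookup (word_monomial w) z \<noteq> 0"
      using Cons.prems False
      by (simp add: lookup_add lookup_single z lookup_push_forward[OF bij_L])
    then obtain v where "word_rewrite w (z # v)" using Cons.IH by blast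
    then have "word_rewrite (x # w) (L x z # R x z # v)"
      by (blast intro: word_rewrite.intros)
    then show ?thesis using z by blast
  qed
qed simp

text \<open>For the converse, the first letter of \<open>v\<close> occurs in the common monomial and
  so can be moved to the front of \<open>u\<close>; cancelling it and its permutation leaves the
  same problem for the tails. In particular rewriting is symmetric, though no rule states
  this.\<close>

lemma word_rewrite_iff: "word_rewrite u v \<longleftrightarrow> word_monomial u = word_monomial v"
proof
  assume "word_monomial u = word_monomial v"
  then show "word_rewrite u v"
  proof (induction v arbitrary: u)
    case Nil
    have "u = []"
    proof (rule ccontr)
      assume "u \<noteq> []"
      then obtain x w where "u = x # w" by (cases u) auto
      then have "Poly_Mapping.lookup (word_monomial u) x \<noteq> 0" by (simp add: lookup_add)
      then show False using Nil by simp
    qed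
    then show ?case by (simp add: refl)
  next
    case (Cons y v)
    have "Poly_Mapping.lookup (word_monomial u) y \<noteq> 0" by (simp add: Cons.prems lookup_add)
    then obtain w where w: "word_rewrite u (y # w)" using word_rewrite_to_front by blast
    then have "permute y (word_monomial w) = permute y (word_monomial v)"
      using word_rewrite_monomial[OF w] Cons.prems by simp
    then have "word_monomial w = word_monomial v"
      using bij_push_forward[OF bij_L] by (metis bij_is_inj injD)
    then show ?case using Cons.IH w by (blast intro: word_rewrite.intros)
  qed
qed (rule word_rewrite_monomial)

text \<open>Each rule matches a closure property of an ideal: \<open>refl\<close> zero,
  \<open>trans\<close> a telescoping sum, \<open>Cons\<close> left multiplication by a letter,
  \<open>swap\<close> right multiplication of a relator by the tail.\<close>

lemma word_rewrite_ideal: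
  fixes I :: "('x, 'k::field) free_alg set"
  assumes I: "ideal I monoid_algebra" and rel: "yang_baxter_relators r \<subseteq> I"
  shows "word_rewrite u v \<Longrightarrow> Poly_Mapping.single (Word u) 1 - Poly_Mapping.single (Word v) 1 \<in> I"
proof (induction rule: word_rewrite.induct)
  case (refl w)
  show ?case using ideal_monoid_algebra_closed(1)[OF I] by simp
next
  case (trans u v w)
  then show ?case using ideal_monoid_algebra_closed(2)[OF I trans.IH] by simp
next
  case (Cons u v x)
  from ideal_monoid_algebra_closed(3)[OF I Cons.IH, of "Poly_Mapping.single (Word [x]) 1"]
  show ?case by (simp add: right_diff_distrib mult_single plus_free_monoid_def)
next
  case (swap x y w)
  have "free_gen x * free_gen y - free_gen (L x y) * free_gen (R x y) \<in> I"
    using rel unfolding yang_baxter_relators_def by blast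
  from ideal_monoid_algebra_closed(4)[OF I this, of "Poly_Mapping.single (Word w) 1"]
  show ?case by (simp add: free_gen_def left_diff_distrib mult_single plus_free_monoid_def)
qed

end

section \<open>The twist\<close>

locale finite_distributive_solution = distributive_solution r
  for r :: "'x::finite \<times> 'x \<Rightarrow> 'x \<times> 'x" +
  fixes p :: nat and e :: "nat \<Rightarrow> 'x"
  assumes enum: "e ` {1..p} = UNIV"
begin

text \<open>The choice depends on \<open>x\<close> only through the permutation \<open>L x\<close>.
  Letters with equal left translations thus share a degree, although \<open>e\<close> enumerates
  letters.\<close>

definition index :: "'x \<Rightarrow> nat"
  where "index x = (SOME s. s \<in> {1..p} \<and> L (e s) = L x)"

lemma index: "index x \<in> {1..p}" "L (e (index x)) = L x"
proof -
  have "x \<in> e ` {1..p}" unfolding enum by simp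
  then have "\<exists>s. s \<in> {1..p} \<and> L (e s) = L x" by auto
  from someI_ex[OF this] show "index x \<in> {1..p}" "L (e (index x)) = L x"
    by (simp_all add: index_def)
qed

lemma index_L: "index \<circ> L x = index"
  by (simp add: fun_eq_iff index_def L_L)

definition monomial_degree :: "('x \<Rightarrow>\<^sub>0 nat) \<Rightarrow> nat \<Rightarrow> nat"
  where "monomial_degree m = Poly_Mapping.lookup (push_forward index m)"

lemma monomial_degree_single:
  "monomial_degree (Poly_Mapping.single x 1) = (\<lambda>s. if s = index x then 1 else 0)"
  by (auto simp: monomial_degree_def lookup_single fun_eq_iff when_def)

lemma monomial_degree_permute: "monomial_degree (permute x m) = monomial_degree m"
  by (simp add: monomial_degree_def push_forward_comp index_L)

sublocale degree_function p monomial_degree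
proof
  fix u v :: "'x \<Rightarrow>\<^sub>0 nat"
  show "monomial_degree 0 = (\<lambda>_. 0)" by (simp add: monomial_degree_def fun_eq_iff)
  show add_deg: "monomial_degree (u + v) = (\<lambda>s. monomial_degree u s + monomial_degree v s)" for u v
    by (simp add: monomial_degree_def fun_eq_iff lookup_add)
  show "monomial_degree u \<in> multidegrees p"
  proof (induction u rule: multiset_poly_mapping_induct)
    case zero
    show ?case by (simp add: monomial_degree_def multidegrees_def)
  next
    case (add x m)
    then show ?case using index(1)[of x]
      unfolding multidegrees_def add_deg monomial_degree_single by auto
  qed
qed

text \<open>The permutation by which \<open>m\<close>, as a left factor, twists the right factor; it
  depends only on the degree of \<open>m\<close>.\<close>

definition monomial_action :: "('x \<Rightarrow>\<^sub>0 nat) \<Rightarrow> 'x \<Rightarrow> 'x"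
  where "monomial_action m = multipower p (\<lambda>s. L (e s)) (monomial_degree m)"

text \<open>Permuting variables preserves degrees, so the degrees of the letters add up along a
  word. Each letter \<open>x\<close> then contributes \<open>L (e (index x)) = L x\<close>.\<close>

lemma monomial_action_word: "monomial_action (word_monomial w) = word_action w"
proof (induction w)
  case Nil
  show ?case
    by (simp add: monomial_action_def deg_zero multipower_zero word_action_def)
next
  case (Cons x w)
  have "monomial_action (word_monomial (x # w)) =
      monomial_action (Poly_Mapping.single x 1) \<circ> monomial_action (word_monomial w)"
    unfolding monomial_action_def word_monomial.simps deg_add monomial_degree_permute
    by (rule multipower_add) (simp add: fun_eq_iff L_commute)
  moreover have "monomial_action (Poly_Mapping.single x 1) = L x"
    unfolding monomial_action_def monomial_degree_single using index by (simp add: multipower_unit)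
  ultimately show ?case using Cons by (simp add: word_action_def fun_eq_iff)
qed

section \<open>The twisting automorphisms\<close>

abbreviation component :: "(nat \<Rightarrow> nat) \<Rightarrow> ('x, 'k::field) poly_algebra set"
  where "component \<equiv> degree_component monomial_degree"

definition twist :: "nat \<Rightarrow> ('x, 'k::field) poly_algebra \<Rightarrow> ('x, 'k) poly_algebra"
  where "twist s = push_forward (permute (e s))"

lemma twist_image_component: "twist s ` component d = component d"
proof
  \<comment> \<open>Stated for every degree-preserving renaming \<open>T\<close>, so that it serves
    \<open>L (e s)\<close> and its inverse alike.\<close>
  have deg: "push_forward (push_forward T) f \<in> component d"
    if "f \<in> component d" "\<And>m. monomial_degree (push_forward T m) = monomial_degree m"
    for T and f :: "('x, 'k::field) poly_algebra"
  proof -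
    have "Poly_Mapping.keys (push_forward (push_forward T) f) \<subseteq>
        push_forward T ` Poly_Mapping.keys f"
      unfolding push_forward_def[of "push_forward T" f]
      by (rule order_trans[OF Poly_Mapping.keys_sum]) (auto split: if_splits)
    then show ?thesis using that by (auto simp: degree_component_def)
  qed
  show "twist s ` component d \<subseteq> component d"
    using deg monomial_degree_permute by (auto simp: twist_def)
  show "component d \<subseteq> twist s ` component d"
  proof
    fix f :: "('x, 'k::field) poly_algebra"
    assume f: "f \<in> component d"
    let ?T = "inv_into UNIV (L (e s))"
    have LT: "L (e s) \<circ> ?T = id"
      using bij_L[of "e s"] by (simp add: bij_is_surj surj_iff[symmetric])
    have "monomial_degree (push_forward ?T m) = monomial_degree m" for m
      using monomial_degree_permute[of "e s" "push_forward ?T m"]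
      by (simp add: push_forward_inverse[OF LT])
    from deg[OF f this] have "push_forward (push_forward ?T) f \<in> component d" .
    moreover have "f = twist s (push_forward (push_forward ?T) f)"
      unfolding twist_def
      by (rule push_forward_inverse[symmetric]) (simp add: LT flip: push_forward_comp_fun)
    ultimately show "f \<in> twist s ` component d" by blast
  qed
qed

lemma commuting_twists:
  "commuting_graded_automorphisms p
    (polynomial_algebra :: ('k::field, ('x, 'k) poly_algebra) module) component twist"
proof -
  have "twist s \<in> algebra_iso (polynomial_algebra :: ('k, ('x, 'k) poly_algebra) module) monoid_algebra"
    for s
    unfolding twist_def by (rule push_forward_algebra_iso) (simp_all add: bij_push_forward bij_L)
  moreover have "twist s (twist t f) = twist t (twist s f)" for s t and f :: "('x, 'k) poly_algebra"
  proof -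
    have "L (e s) \<circ> L (e t) = L (e t) \<circ> L (e s)" by (simp add: fun_eq_iff L_commute)
    then show ?thesis
      by (simp add: twist_def push_forward_comp flip: push_forward_comp_fun)
  qed
  ultimately show ?thesis
    by (simp add: commuting_graded_automorphisms_def twist_image_component)
qed

text \<open>Double push-forward respects composition, so products of powers of the twists are
  induced by the same products of permutations.\<close>

lemma multipower_twist:
  "multipower p twist (monomial_degree u) = push_forward (push_forward (monomial_action u))"
  unfolding twist_def[abs_def] monomial_action_def
  by (rule multipower_functor[where F = "\<lambda>T. push_forward (push_forward T)"])
    (simp_all add: push_forward_comp_fun)

section \<open>The product of the twist\<close>

abbreviation twist_product ::
  "('x, 'k::field) poly_algebra \<Rightarrow> ('x, 'k) poly_algebra \<Rightarrow> ('x, 'k) poly_algebra"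
  where "twist_product \<equiv> twisted_mult p polynomial_algebra component twist"

lemma twist_product_single:
  "twist_product (Poly_Mapping.single u c) g =
    Poly_Mapping.single u c * push_forward (push_forward (monomial_action u)) g"
  by (simp add: twisted_mult_eq multipower_twist)

lemma twist_product_add_left: "twist_product (f + f') g = twist_product f g + twist_product f' g"
  unfolding twisted_mult_eq multipower_twist
  by (rule setsum_keys_plus_distrib) (simp_all add: single_add distrib_right)

section \<open>The homomorphism from the free algebra and its kernel\<close>

abbreviation twisted_algebra :: "('k::field, ('x, 'k) poly_algebra) module"
  where "twisted_algebra \<equiv> zhang_twist p polynomial_algebra component twist"

definition word_map :: "('x, 'k::field) free_alg \<Rightarrow> ('x, 'k) poly_algebra"
  where "word_map = push_forward (\<lambda>w. word_monomial (letters w))"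

text \<open>Additivity in both factors reduces the claim to two words. There
  \<open>word_monomial_append\<close> is the product rule of the twist, since
  \<open>monomial_action_word\<close> identifies the two permutations.\<close>

lemma word_map_mult: "word_map (f * g) = twist_product (word_map f) (word_map g)"
proof (induction f rule: poly_mapping_induct_add)
  case (single u c)
  show ?case
    by (induction g rule: poly_mapping_induct_add)
      (simp_all add: word_map_def mult_single plus_free_monoid_def word_monomial_append
        twist_product_single monomial_action_word distrib_left)
next
  case (add f f')
  then show ?case by (simp add: word_map_def distrib_right twist_product_add_left)
qed

lemma word_map_ring_hom:
  "word_map \<in> ring_hom (free_algebra :: ('k::field, ('x, 'k) free_alg) module) twisted_algebra"
proof -
  have letters_zero: "letters (0 :: 'x free_monoid) = []" by (simp add: zero_free_monoid_def)
  have "word_map (1 :: ('x, 'k) free_alg) = 1"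
    using push_forward_single[of "\<lambda>w. word_monomial (letters w)" "0 :: 'x free_monoid" "1 :: 'k"]
    by (simp add: word_map_def letters_zero)
  moreover have "word_map (f + g) = word_map f + word_map g" for f g :: "('x, 'k) free_alg"
    by (simp add: word_map_def)
  ultimately show ?thesis
    by (intro ring_hom_memI) (simp_all add: zhang_twist_def monoid_algebra_simps word_map_mult)
qed

lemma surj_word_map: "surj word_map"
proof -
  have "g \<in> range word_map" for g :: "('x, 'k::field) poly_algebra"
  proof (induction g rule: poly_mapping_induct_add)
    case (single m c)
    obtain w where "m = word_monomial w" using surj_word_monomial by blast
    then have "Poly_Mapping.single m c = word_map (Poly_Mapping.single (Word w) c)"
      by (simp add: word_map_def)
    then show ?case by blast
  next
    case (add g h)
    then obtain f f' where "g = word_map f" "h = word_map f'" by blast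
    then have "g + h = word_map (f + f')" by (simp add: word_map_def)
    then show ?case by blast
  qed
  then show ?thesis by blast
qed

text \<open>The ring axioms of the twist, associativity included, are inherited from the free
  algebra, of which it is a homomorphic image.\<close>

lemma word_map_ring_hom_ring:
  "ring_hom_ring (free_algebra :: ('k::field, ('x, 'k) free_alg) module) twisted_algebra word_map"
proof (rule ring_hom_ringI2)
  let ?F = "free_algebra :: ('k, ('x, 'k) free_alg) module"
  let ?T = "twisted_algebra :: ('k, ('x, 'k) poly_algebra) module"
  show "ring ?F" by (rule ring_monoid_algebra)
  show "word_map \<in> ring_hom ?F ?T" by (rule word_map_ring_hom)
  \<comment> \<open>By surjectivity the image structure of \<open>word_map\<close> is the whole
    twisted algebra.\<close>
  have eq: "?T\<lparr>carrier := word_map ` carrier ?F, zero := word_map \<zero>\<^bsub>?F\<^esub>\<rparr> = ?T"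
    by (simp add: zhang_twist_def monoid_algebra_def surj_word_map) (simp add: word_map_def)
  show "ring ?T"
    using ring.ring_hom_imp_img_ring[OF ring_monoid_algebra, of word_map ?T, OF word_map_ring_hom]
    unfolding eq .
qed

text \<open>Relators vanish because a swap preserves the monomial. Conversely, words with the same
  monomial are linked by rewriting, so their difference lies in the ideal, and such differences span
  the kernel.\<close>

lemma kernel_word_map:
  "a_kernel (free_algebra :: ('k::field, ('x, 'k) free_alg) module) twisted_algebra word_map =
    Idl\<^bsub>free_algebra\<^esub> (yang_baxter_relators r)"
proof
  let ?F = "free_algebra :: ('k, ('x, 'k) free_alg) module"
  let ?K = "a_kernel ?F twisted_algebra word_map"
  let ?I = "Idl\<^bsub>?F\<^esub> (yang_baxter_relators r)"
  interpret ring ?F by (rule ring_monoid_algebra)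
  have K: "?K = {f. word_map f = 0}"
    by (simp add: a_kernel_def' zhang_twist_def monoid_algebra_def)
  have carr: "yang_baxter_relators r \<subseteq> carrier ?F" by (simp add: monoid_algebra_def)
  show "?I \<subseteq> ?K"
  proof (rule genideal_minimal)
    show "ideal ?K ?F" by (rule ring_hom_ring.kernel_is_ideal[OF word_map_ring_hom_ring])
    show "yang_baxter_relators r \<subseteq> ?K"
    proof
      fix f :: "('x, 'k) free_alg"
      assume "f \<in> yang_baxter_relators r"
      then obtain x y where f: "f = free_gen x * free_gen y - free_gen (L x y) * free_gen (R x y)"
        by (auto simp: yang_baxter_relators_def)
      have "word_monomial [x, y] = word_monomial [L x y, R x y]"
        by (rule word_rewrite_monomial, rule word_rewrite.swap)
      then have "word_map f = 0"
        by (simp add: f free_gen_def mult_single plus_free_monoid_def word_map_def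
            del: word_monomial.simps)
      then show "f \<in> ?K" by (simp add: K)
    qed
  qed
  show "?K \<subseteq> ?I"
  proof
    fix f assume "f \<in> ?K"
    then have f: "push_forward (\<lambda>w. word_monomial (letters w)) f = 0"
      unfolding K by (simp add: word_map_def)
    have I: "ideal ?I ?F" by (rule genideal_ideal[OF carr])
    show "f \<in> ?I"
    proof (rule kernel_push_forward_subset[OF I _ f])
      fix u v :: "'x free_monoid"
      assume "word_monomial (letters u) = word_monomial (letters v)"
      then have "word_rewrite (letters u) (letters v)" by (simp add: word_rewrite_iff)
      from word_rewrite_ideal[OF I genideal_self[OF carr] this]
      show "Poly_Mapping.single u 1 - Poly_Mapping.single v 1 \<in> ?I" by simp
    qed
  qed
qed

lemma yang_baxter_algebra_isomorphic_twist:
  "algebra_isomorphic (yang_baxter_algebra r :: ('k::field, ('x, 'k) free_alg set) module)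
    twisted_algebra"
  unfolding yang_baxter_algebra_def kernel_word_map[symmetric]
proof (rule quotient_algebra_isomorphic[OF HOL.refl word_map_ring_hom_ring])
  show "range word_map = carrier (twisted_algebra :: ('k, ('x, 'k) poly_algebra) module)"
    by (simp add: surj_word_map zhang_twist_def monoid_algebra_def)
  fix c and f :: "('x, 'k) free_alg"
  have "word_map (Poly_Mapping.single 0 c * f) = Poly_Mapping.single 0 c * word_map f"
    by (induction f rule: poly_mapping_induct_add)
      (simp_all add: word_map_def mult_single distrib_left)
  then show "word_map (c \<odot>\<^bsub>free_algebra\<^esub> f) = c \<odot>\<^bsub>twisted_algebra\<^esub> word_map f"
    by (simp add: zhang_twist_def monoid_algebra_def)
qed

end

theorem proposition3p4:
  fixes r :: "'x::finite \<times> 'x \<Rightarrow> 'x \<times> 'x"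
  assumes "set_theoretic_solution r"
    and "nondegenerate r"
    and "involutive r"
    and "distributive r"
  shows "\<exists>p\<ge>1. \<exists>G \<phi>.
    is_grading p (polynomial_algebra :: ('k::field_char_0, ('x, 'k) poly_algebra) module) G \<and>
    commuting_graded_automorphisms p polynomial_algebra G \<phi> \<and>
    algebra_isomorphic
      (yang_baxter_algebra r :: ('k, ('x, 'k) free_alg set) module)
      (zhang_twist p polynomial_algebra G \<phi>)"
proof -
  \<comment> \<open>The rank \<open>p\<close> of the grading is the number of elements of the
    solution, which is positive because a type is nonempty.\<close>
  obtain e where "bij_betw e {1..card (UNIV :: 'x set)} (UNIV :: 'x set)"
    using ex_bij_betw_nat_finite_1[of "UNIV :: 'x set"] by auto
  then interpret finite_distributive_solution r "card (UNIV :: 'x set)" e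
    using assms by unfold_locales (simp_all add: bij_betw_def)
  have "1 \<le> card (UNIV :: 'x set)" by (simp add: Suc_le_eq card_gt_0_iff)
  then show ?thesis
    using is_grading_degree_component commuting_twists yang_baxter_algebra_isomorphic_twist
    by blast
qed

end
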